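(* Assume that numbers are independent and identically distributed, and that there are no identical numbers within any length-$n$ string. Let $n \ge 1$ and let $S_1[1..n]$ and $S_2[1..n]$ be two such independent random strings. Then the probability $p(n)$ that $S_1$ and $S_2$ have the same Cartesian tree satisfies $p(n) \le \frac{1}{2^{n-1}}$.
   Context: The Cartesian tree $CT(S)$ of a string $S[1..n]$ (a sequence of numbers) is defined recursively: if $S$ is empty, $CT(S)$ is the empty tree; otherwise, if $S[i]$ is the minimum value in $S[1..n]$ (the leftmost one if there are several), $CT(S)$ is the binary tree with root $S[i]$, left subtree $CT(S[1..i-1])$ and right subtree $CT(S[i+1..n])$. Two strings "have the same Cartesian tree" (match) if their Cartesian trees are equal as (unlabeled) binary tree shapes. $S[i..j]$ denotes the substring from position $i$ to position $j$. *)

theory Defs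
  imports "HOL-Probability.Probability" "HOL-Library.Tree"
begin

definition leftmost_min :: "'a::linorder list \<Rightarrow> nat" where
  "leftmost_min S = (LEAST i. i < length S \<and> S ! i = Min (set S))"

lemma leftmost_min_less:
  assumes "S \<noteq> []"
  shows "leftmost_min S < length S"
proof -
  have "Min (set S) \<in> set S"
    using assms by simp
  then have "\<exists>i. i < length S \<and> S ! i = Min (set S)"
    by (simp add: in_set_conv_nth)
  from LeastI_ex[OF this] show ?thesis
    by (simp add: leftmost_min_def)
qed

function cartesian_tree :: "'a::linorder list \<Rightarrow> 'a tree" where
  "cartesian_tree S =
    (if S = [] then Leaf
     else let i = leftmost_min S
          in Node (cartesian_tree (take i S)) (S ! i) (cartesian_tree (drop (Suc i) S)))"
  by pat_completeness auto
termination
  by (relation "Wellfounded.measure length") (auto simp: leftmost_min_less)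

declare cartesian_tree.simps [simp del]

(* The map_tree erases the node labels, so that only the tree shapes are compared. *)
definition same_cartesian_tree :: "'a::linorder list \<Rightarrow> 'b::linorder list \<Rightarrow> bool" where
  "same_cartesian_tree S T \<longleftrightarrow>
    map_tree (\<lambda>_. ()) (cartesian_tree S) = map_tree (\<lambda>_. ()) (cartesian_tree T)"

definition random_string :: "nat \<Rightarrow> (nat \<Rightarrow> 'w \<Rightarrow> 'a) \<Rightarrow> 'w \<Rightarrow> 'a list" where
  "random_string n X \<omega> = map (\<lambda>i. X i \<omega>) [0..<n]"

end

(* By exchangeability the joint law is unchanged when each of the two strings is permuted.
   Averaging over all pairs of permutations turns p(n) into a count of pairs of permutations of n
   distinct numbers with equal Cartesian trees. The number of permutations with a given tree shape t
   is n! w(t), where 1 / w(t) is the product of the sizes of all nonempty subtrees of t;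
   so p(n) is the sum of w(t)^2 over the shapes t of size n. Splitting at the root gives
   p(n) = (p(0) p(n-1) + ... + p(n-1) p(0)) / n^2, hence inductively, for n >= 2,
   p(n) <= (4 n - 4) / n^2 * 2^(1-n) <= 2^(1-n). *)
theory Submission imports Defs "HOL-Combinatorics.Multiset_Permutations" begin

section \<open>Shapes of Cartesian trees and the split at the minimum\<close>

text \<open>All shapes live in the one type \<open>unit tree\<close>, whatever the type of the list
  entries, so that they can be counted and summed over.\<close>

definition shape :: "'a::linorder list \<Rightarrow> unit tree" where
  "shape S = map_tree (\<lambda>_. ()) (cartesian_tree S)"

lemma shape_Nil [simp]: "shape [] = Leaf"
  by (simp add: shape_def cartesian_tree.simps)

text \<open>Strictness on the left rules out an earlier occurrence of the minimum; ties can only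
  occur on the right.\<close>

lemma leftmost_min_split:
  assumes "\<forall>y\<in>set ys. x < y" "\<forall>z\<in>set zs. x \<le> z"
  shows "leftmost_min (ys @ x # zs) = length ys"
proof -
  have Min: "Min (set (ys @ x # zs)) = x"
    using assms by (intro Min_eqI) auto
  show ?thesis
    unfolding leftmost_min_def Min
  proof (rule Least_equality)
    fix i assume "i < length (ys @ x # zs) \<and> (ys @ x # zs) ! i = x"
    with assms(1) show "length ys \<le> i"
      by (metis less_irrefl not_le nth_append nth_mem)
  qed simp
qed

lemma shape_split:
  assumes "\<forall>y\<in>set ys. x < y" "\<forall>z\<in>set zs. x \<le> z"
  shows "shape (ys @ x # zs) = Node (shape ys) () (shape zs)"
  unfolding shape_def
  by (subst cartesian_tree.simps) (simp add: Let_def leftmost_min_split[OF assms])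

text \<open>Cutting at the first occurrence of the minimum makes the inequalities on the left
  strict.\<close>

lemma leftmost_min_splitE:
  fixes S :: "'a::linorder list"
  assumes "S \<noteq> []"
  obtains ys x zs where "S = ys @ x # zs" "\<forall>y\<in>set ys. x < y" "\<forall>z\<in>set zs. x \<le> z"
proof -
  have "Min (set S) \<in> set S"
    using assms by simp
  then obtain ys zs where S: "S = ys @ Min (set S) # zs" "Min (set S) \<notin> set ys"
    using split_list_first by metis
  define m where "m = Min (set S)"
  have S: "S = ys @ m # zs" "m \<notin> set ys"
    using S by (simp_all add: m_def)
  have "m \<le> y" if "y \<in> set S" for y
    using that by (simp add: m_def)
  then have "\<forall>y\<in>set ys. m \<le> y" "\<forall>z\<in>set zs. m \<le> z"
    by (simp_all add: S(1))
  with S show thesis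
    by (intro that[of ys m zs]) (auto simp: less_le)
qed

lemma size_shape [simp]: "size (shape S) = length S"
proof (induction S rule: length_induct)
  case (1 S)
  show ?case
  proof (cases "S = []")
    case False
    then obtain ys x zs where "S = ys @ x # zs" "\<forall>y\<in>set ys. x < y" "\<forall>z\<in>set zs. x \<le> z"
      by (rule leftmost_min_splitE)
    then show ?thesis
      using 1 by (simp add: shape_split)
  qed simp
qed

lemma shape_eq_Leaf_iff [simp]: "shape S = Leaf \<longleftrightarrow> S = []"
  by (metis eq_size_0 length_0_conv size_shape)

text \<open>Inverts the recursion at the root: both the counting of permutations and the
  measurability proof descend along the shape with it.\<close>

lemma shape_eq_Node_iff:
  "shape S = Node l () r \<longleftrightarrow>
    (\<exists>ys x zs. S = ys @ x # zs \<and> (\<forall>y\<in>set ys. x < y) \<and> (\<forall>z\<in>set zs. x \<le> z) \<and>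
      shape ys = l \<and> shape zs = r)" (is "_ \<longleftrightarrow> ?R")
proof
  assume *: "shape S = Node l () r"
  then have "S \<noteq> []" by auto
  then obtain ys x zs where "S = ys @ x # zs" "\<forall>y\<in>set ys. x < y" "\<forall>z\<in>set zs. x \<le> z"
    by (rule leftmost_min_splitE)
  with * show ?R
    by (intro exI[of _ ys] exI[of _ x] exI[of _ zs]) (simp add: shape_split)
qed (auto simp: shape_split)

section \<open>Hook length weights and the number of permutations of each shape\<close>

text \<open>The probability that a uniformly random permutation of \<open>size t\<close> distinct
  numbers has shape \<open>t\<close>. Each node contributes the reciprocal of the size of its
  subtree, the chance that the minimum of the corresponding block falls at the prescribed
  position.\<close>

fun tree_weight :: "'a tree \<Rightarrow> real" where
  "tree_weight Leaf = 1"
| "tree_weight (Node l x r) = tree_weight l * tree_weight r / (size l + size r + 1)"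

text \<open>The hook length formula for the number of heap orderings of a binary tree.\<close>
lemma card_permutations_of_set_shape:
  fixes A :: "'a::linorder set"
  assumes "finite A" "card A = size t"
  shows "real (card {xs \<in> permutations_of_set A. shape xs = t}) = fact (size t) * tree_weight t"
  using assms
proof (induction t arbitrary: A)
  case Leaf
  then have "{xs \<in> permutations_of_set A. shape xs = Leaf} = {[]}"
    by auto
  then show ?case by simp
next
  case (Node l u r)
  define P where "P t B = {xs \<in> permutations_of_set B. shape xs = t}" for t and B :: "'a set"
  define m where "m = Min A"
  define A' where "A' = A - {m}"
  \<comment> \<open>The root carries the minimum \<open>m\<close>, so a permutation of shape
    \<open>Node l u r\<close> amounts to a set \<open>B\<close> of values to the left of
    \<open>m\<close> and orderings of \<open>B\<close> and \<open>A' - B\<close> with shapes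
    \<open>l\<close> and \<open>r\<close>.\<close>
  define \<B> where "\<B> = {B. B \<subseteq> A' \<and> card B = size l}"
  have "A \<noteq> {}"
    using Node.prems by auto
  then have m: "m \<in> A" "\<And>a. a \<in> A \<Longrightarrow> m \<le> a"
    using Node.prems by (auto simp: m_def)
  then have A: "A = insert m A'" "m \<notin> A'" "finite A'" "\<And>a. a \<in> A' \<Longrightarrow> m < a"
    using Node.prems by (auto simp: A'_def less_le)
  then have cardA': "card A' = size l + size r"
    using Node.prems by simp
  have fin: "finite (P t B)" for t B
    by (simp add: P_def)
  have "P (Node l u r) A =
      (\<lambda>(B, ys, zs). ys @ m # zs) ` (SIGMA B:\<B>. P l B \<times> P r (A' - B))" (is "_ = ?f ` ?D")
  proof (intro equalityI subsetI)
    fix xs assume "xs \<in> P (Node l u r) A"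
    then have xs: "set xs = A" "distinct xs" "shape xs = Node l () r"
      by (auto simp: P_def permutations_of_set_def)
    then obtain ys x zs where s: "xs = ys @ x # zs" "\<forall>y\<in>set ys. x < y" "\<forall>z\<in>set zs. x \<le> z"
      "shape ys = l" "shape zs = r"
      unfolding shape_eq_Node_iff by blast
    have "x = m"
      unfolding m_def using xs(1) s(1-3) Node.prems(1)
      by (intro Min_eqI[symmetric]) auto
    moreover have "A' = set ys \<union> set zs" "set ys \<inter> set zs = {}"
      using xs(1,2) s(1) \<open>x = m\<close> by (auto simp: A'_def)
    moreover have "length ys = size l"
      using s(4) by auto
    moreover have "distinct ys" "distinct zs"
      using xs(2) s(1) by auto
    ultimately show "xs \<in> ?f ` ?D"
      using s by (intro image_eqI[of _ _ "(set ys, ys, zs)"])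
        (auto simp: P_def \<B>_def permutations_of_set_def distinct_card)
  next
    fix xs assume "xs \<in> ?f ` ?D"
    then obtain B ys zs where *: "B \<in> \<B>" "ys \<in> P l B" "zs \<in> P r (A' - B)" "xs = ys @ m # zs"
      by auto
    then have "set ys \<subseteq> A'" "set zs \<subseteq> A'"
      by (auto simp: P_def \<B>_def permutations_of_set_def)
    then have "shape xs = Node l u r"
      using * A(4) by (auto simp: P_def intro!: shape_split less_imp_le)
    then show "xs \<in> P (Node l u r) A"
      using * A by (auto simp: P_def \<B>_def permutations_of_set_def)
  qed
  moreover have "inj_on ?f ?D"
  proof (rule inj_onI)
    fix p q assume "p \<in> ?D" "q \<in> ?D" "?f p = ?f q"
    then obtain B ys zs B' ys' zs' where *: "p = (B, ys, zs)" "q = (B', ys', zs')"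
      "ys \<in> P l B" "ys' \<in> P l B'" "ys @ m # zs = ys' @ m # zs'"
      by auto
    \<comment> \<open>Both prefixes have length \<open>size l\<close>, which makes the cut of the
      common list unique; \<open>B\<close> is then the set of entries of the prefix.\<close>
    then have "length ys = length ys'" "B = set ys" "B' = set ys'"
      by (auto simp: P_def permutations_of_set_def simp flip: size_shape)
    with * show "p = q"
      by simp
  qed
  ultimately have "card (P (Node l u r) A) = card ?D"
    by (simp add: card_image)
  also have "\<dots> = (\<Sum>B\<in>\<B>. card (P l B \<times> P r (A' - B)))"
    using A(3) fin by (intro card_SigmaI) (auto simp: \<B>_def)
  also have "real \<dots> = (\<Sum>B\<in>\<B>. (fact (size l) * tree_weight l) * (fact (size r) * tree_weight r))"
    unfolding of_nat_sum
  proof (rule sum.cong)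
    fix B assume "B \<in> \<B>"
    then have B: "finite B" "card B = size l" "finite (A' - B)" "card (A' - B) = size r"
      using A(3) cardA' by (auto simp: \<B>_def card_Diff_subset finite_subset)
    show "real (card (P l B \<times> P r (A' - B))) =
        (fact (size l) * tree_weight l) * (fact (size r) * tree_weight r)"
      using Node.IH(1)[OF B(1,2)] Node.IH(2)[OF B(3,4)] by (simp add: P_def card_cartesian_product)
  qed simp
  also have "\<dots> = real ((size l + size r) choose size l) * fact (size l) * fact (size r) *
      (tree_weight l * tree_weight r)"
    using A(3) by (simp add: \<B>_def n_subsets cardA')
  \<comment> \<open>The binomial coefficient for the choice of \<open>B\<close> absorbs both
    factorials. The remaining factor \<open>size l + size r + 1\<close> of the full factorial
    cancels the denominator of \<open>tree_weight\<close> at the root.\<close>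
  also have "real ((size l + size r) choose size l) * fact (size l) * fact (size r) =
      fact (size l + size r)"
    using binomial_fact_lemma[of "size l" "size l + size r"]
    by (metis (no_types, lifting) add_diff_cancel_left' le_add1 mult.assoc mult.commute of_nat_fact of_nat_mult)
  also have "\<dots> * (tree_weight l * tree_weight r) = fact (size (Node l u r)) * tree_weight (Node l u r)"
    by (simp add: field_simps)
  finally show ?case
    by (simp add: P_def)
qed

section \<open>The sum of squared weights over all shapes of a given size\<close>

definition trees_of_size :: "nat \<Rightarrow> unit tree set" where
  "trees_of_size n = {t. size t = n}"

lemma trees_of_size_0 [simp]: "trees_of_size 0 = {Leaf}"
  by (auto simp: trees_of_size_def)

text \<open>Keeping the size \<open>k\<close> of the left subtree as an explicit index turns sums
  over shapes into convolutions.\<close>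

lemma trees_of_size_Suc:
  "trees_of_size (Suc n) =
    (\<lambda>(k, l, r). Node l () r) ` (SIGMA k:{..n}. trees_of_size k \<times> trees_of_size (n - k))"
proof (intro equalityI subsetI)
  fix t assume "t \<in> trees_of_size (Suc n)"
  then show "t \<in> (\<lambda>(k, l, r). Node l () r) ` (SIGMA k:{..n}. trees_of_size k \<times> trees_of_size (n - k))"
    by (cases t) (auto simp: trees_of_size_def image_iff intro!: bexI[of _ "(size (left t), left t, right t)"])
qed (auto simp: trees_of_size_def)

lemma finite_trees_of_size [simp]: "finite (trees_of_size n)"
proof (induction n rule: less_induct)
  case (less n)
  then show ?case
    by (cases n) (auto simp: trees_of_size_Suc intro!: finite_imageI finite_SigmaI)
qed

text \<open>All shapes of size \<open>n + 1\<close> have the same denominator \<open>n + 1\<close>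
  at the root, and the rest of the squared weight factors over the two subtrees.\<close>

lemma sum_tree_weight_Suc:
  "(\<Sum>t\<in>trees_of_size (Suc n). (tree_weight t)\<^sup>2) =
    (\<Sum>k\<le>n. (\<Sum>l\<in>trees_of_size k. (tree_weight l)\<^sup>2) * (\<Sum>r\<in>trees_of_size (n - k). (tree_weight r)\<^sup>2))
      / (real n + 1)\<^sup>2"
proof -
  have inj: "inj_on (\<lambda>(k, l, r). Node l () r) (SIGMA k:{..n}. trees_of_size k \<times> trees_of_size (n - k))"
    by (auto simp: inj_on_def trees_of_size_def)
  have "(\<Sum>t\<in>trees_of_size (Suc n). (tree_weight t)\<^sup>2) =
      (\<Sum>(k, l, r)\<in>(SIGMA k:{..n}. trees_of_size k \<times> trees_of_size (n - k)). (tree_weight (Node l () r))\<^sup>2)"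
    unfolding trees_of_size_Suc by (subst sum.reindex[OF inj]) (simp add: case_prod_unfold)
  also have "\<dots> = (\<Sum>(k, l, r)\<in>(SIGMA k:{..n}. trees_of_size k \<times> trees_of_size (n - k)).
      (tree_weight l)\<^sup>2 * (tree_weight r)\<^sup>2 / (real n + 1)\<^sup>2)"
    by (intro sum.cong) (auto simp: trees_of_size_def power_mult_distrib power_divide)
  also have "\<dots> = (\<Sum>k\<le>n. \<Sum>(l, r)\<in>trees_of_size k \<times> trees_of_size (n - k).
      (tree_weight l)\<^sup>2 * (tree_weight r)\<^sup>2 / (real n + 1)\<^sup>2)"
    by (subst sum.Sigma) auto
  finally show ?thesis
    by (simp add: sum_product sum.cartesian_product sum_divide_distrib case_prod_unfold)
qed

lemma sum_tree_weight_le: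
  "(\<Sum>t\<in>trees_of_size n. (tree_weight t)\<^sup>2) \<le> (if n = 0 then 1 else 1 / 2 ^ (n - 1))"
proof (induction n rule: less_induct)
  case (less n)
  define a where "a n = (\<Sum>t\<in>trees_of_size n. (tree_weight t)\<^sup>2)" for n
  have a0: "a 0 = 1" and nonneg: "\<And>k. a k \<ge> 0"
    by (auto simp: a_def intro: sum_nonneg)
  \<comment> \<open>The form \<open>2 / 2 ^ k\<close> avoids truncated subtraction when exponents
    are added. At \<open>k = 0\<close> the exact value 1 is kept, as 2 would double the outer terms
    of the convolution.\<close>
  have IH: "a k \<le> 2 / 2 ^ k" if "k < n" "k > 0" for k
    using less[OF that(1)] that(2) by (cases k) (auto simp: a_def)
  consider "n = 0" | "n = 1" | m where "n = m + 2"
    by (metis One_nat_def add_2_eq_Suc' not0_implies_Suc)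
  then show ?case
  proof cases
    case 3
    \<comment> \<open>The indices \<open>0\<close> and \<open>m + 1\<close>, where one subtree is
      empty, are split off.\<close>
    have "{..m + 1} = insert 0 (insert (m + 1) {1..m})"
      by auto
    then have split: "(\<Sum>k\<le>m + 1. a k * a (m + 1 - k)) = 2 * a (m + 1) + (\<Sum>k=1..m. a k * a (m + 1 - k))"
      by (simp only:) (simp add: a0)
    have "(\<Sum>k=1..m. a k * a (m + 1 - k)) \<le> (\<Sum>k=1..m. 4 / 2 ^ (m + 1))"
    proof (rule sum_mono)
      fix k assume k: "k \<in> {1..m}"
      then have "a k * a (m + 1 - k) \<le> (2 / 2 ^ k) * (2 / 2 ^ (m + 1 - k))"
        using 3 by (intro mult_mono IH nonneg) auto
      also have "\<dots> = 4 / 2 ^ (k + (m + 1 - k))"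
        by (simp only: power_add) simp
      finally show "a k * a (m + 1 - k) \<le> 4 / 2 ^ (m + 1)"
        using k by simp
    qed
    then have "(\<Sum>k\<le>m + 1. a k * a (m + 1 - k)) \<le> 2 * (2 / 2 ^ (m + 1)) + m * (4 / 2 ^ (m + 1))"
      using IH[of "m + 1"] 3 unfolding split by simp
    also have "\<dots> = 4 * (m + 1) / 2 ^ (m + 1)"
      by (simp add: field_simps)
    \<comment> \<open>The gap between the numerators is a square:
      \<open>(m + 2)^2 = 4 * (m + 1) + m^2\<close>.\<close>
    also have "\<dots> \<le> (m + 2)\<^sup>2 / 2 ^ (m + 1)"
      by (intro divide_right_mono) (auto simp: power2_eq_square algebra_simps)
    finally have "(\<Sum>k\<le>m + 1. a k * a (m + 1 - k)) / (m + 2)\<^sup>2 \<le> 1 / 2 ^ (m + 1)"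
      by (simp add: field_simps)
    moreover have "a n = (\<Sum>k\<le>m + 1. a k * a (m + 1 - k)) / (m + 2)\<^sup>2"
      using sum_tree_weight_Suc[of "m + 1"] 3 by (simp add: a_def algebra_simps)
    ultimately show ?thesis
      using 3 by (simp add: a_def)
  qed (simp_all add: sum_tree_weight_Suc)
qed

section \<open>Counting permutations of positions\<close>

text \<open>Exchangeability permutes positions, whereas the hook length formula counts arrangements
  of values. Injectivity of \<open>x\<close> makes the passage from \<open>\<sigma>\<close> to the
  rearranged list a bijection between the two.\<close>

lemma card_permutes_shape:
  fixes x :: "nat \<Rightarrow> 'a::linorder"
  assumes inj: "inj_on x {..<n}" and t: "size t = n"
  shows "real (card {\<sigma>. \<sigma> permutes {..<n} \<and> shape (map (\<lambda>i. x (\<sigma> i)) [0..<n]) = t}) =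
    fact n * tree_weight t"
proof -
  let ?S = "{\<sigma>. \<sigma> permutes {..<n}}" and ?A = "x ` {..<n}"
  let ?f = "\<lambda>\<sigma>. map (\<lambda>i. x (\<sigma> i)) [0..<n]"
  have cardA: "card ?A = n"
    using inj by (simp add: card_image)
  have inj_f: "inj_on ?f ?S"
  proof (rule inj_onI, clarify)
    fix \<sigma> \<tau> assume *: "\<sigma> permutes {..<n}" "\<tau> permutes {..<n}" "?f \<sigma> = ?f \<tau>"
    show "\<sigma> = \<tau>"
    proof
      fix i show "\<sigma> i = \<tau> i"
      proof (cases "i < n")
        case True
        then have "x (\<sigma> i) = x (\<tau> i)" "\<sigma> i \<in> {..<n}" "\<tau> i \<in> {..<n}"
          using * permutes_in_image[OF *(1)] permutes_in_image[OF *(2)] by auto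
        then show ?thesis
          using inj by (auto dest: inj_onD)
      next
        case False
        then show ?thesis
          using *(1,2) by (simp add: permutes_not_in)
      qed
    qed
  qed
  have "?f ` ?S \<subseteq> permutations_of_set ?A"
  proof clarify
    fix \<sigma> assume \<sigma>: "\<sigma> permutes {..<n}"
    have "inj_on (x \<circ> \<sigma>) {..<n}"
      using \<sigma> inj by (intro comp_inj_on) (auto simp: permutes_image permutes_inj_on)
    moreover have "set (?f \<sigma>) = x ` (\<sigma> ` {..<n})"
      by (auto simp: image_image atLeast0LessThan)
    ultimately show "?f \<sigma> \<in> permutations_of_set ?A"
      using \<sigma> by (intro permutations_of_setI)
        (simp_all add: permutes_image distinct_map atLeast0LessThan comp_def)
  qed
  \<comment> \<open>Surjectivity comes from counting: an injective image inside a finite set that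
    also has \<open>n!\<close> elements is the whole set.\<close>
  moreover have "card (?f ` ?S) = card (permutations_of_set ?A)"
    using cardA by (simp add: card_image[OF inj_f] card_permutations)
  ultimately have "?f ` ?S = permutations_of_set ?A"
    by (intro card_subset_eq) auto
  then have "{xs \<in> permutations_of_set ?A. shape xs = t} = ?f ` {\<sigma> \<in> ?S. shape (?f \<sigma>) = t}"
    by auto
  moreover have "inj_on ?f {\<sigma> \<in> ?S. shape (?f \<sigma>) = t}"
    using inj_f by (rule inj_on_subset) auto
  ultimately have "card {xs \<in> permutations_of_set ?A. shape xs = t} = card {\<sigma> \<in> ?S. shape (?f \<sigma>) = t}"
    by (simp add: card_image)
  with card_permutations_of_set_shape[of ?A t] t cardA show ?thesis
    by simp
qed

text \<open>Pairs are grouped by their common shape \<open>t\<close>, with the square of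
  \<open>fact n * tree_weight t\<close> pairs in each group. What matters later is that the count is
  the same for all injective \<open>x\<close> and \<open>y\<close>.\<close>

lemma card_permutes_same_cartesian_tree:
  fixes x :: "nat \<Rightarrow> 'a::linorder" and y :: "nat \<Rightarrow> 'b::linorder"
  assumes "inj_on x {..<n}" "inj_on y {..<n}"
  shows "real (card {(\<sigma>, \<tau>). \<sigma> permutes {..<n} \<and> \<tau> permutes {..<n} \<and>
      same_cartesian_tree (map (\<lambda>i. x (\<sigma> i)) [0..<n]) (map (\<lambda>i. y (\<tau> i)) [0..<n])}) =
    (fact n)\<^sup>2 * (\<Sum>t\<in>trees_of_size n. (tree_weight t)\<^sup>2)" (is "real (card ?C) = _")
proof -
  define A where "A t = {\<sigma>. \<sigma> permutes {..<n} \<and> shape (map (\<lambda>i. x (\<sigma> i)) [0..<n]) = t}" for t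
  define B where "B t = {\<tau>. \<tau> permutes {..<n} \<and> shape (map (\<lambda>i. y (\<tau> i)) [0..<n]) = t}" for t
  have "finite (A t)" "finite (B t)" for t
    using finite_permutations[of "{..<n}"] by (auto simp: A_def B_def)
  moreover have "?C = (\<Union>t\<in>trees_of_size n. A t \<times> B t)"
    by (auto simp: A_def B_def trees_of_size_def same_cartesian_tree_def simp flip: shape_def)
  ultimately have "card ?C = (\<Sum>t\<in>trees_of_size n. card (A t \<times> B t))"
    by (simp only:) (rule card_UN_disjoint; auto simp: A_def)
  also have "real \<dots> = (\<Sum>t\<in>trees_of_size n. (fact n * tree_weight t) * (fact n * tree_weight t))"
    using assms unfolding of_nat_sum
    by (intro sum.cong)
      (auto simp: A_def B_def card_cartesian_product card_permutes_shape trees_of_size_def)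
  finally show ?thesis
    by (simp add: sum_distrib_left power2_eq_square algebra_simps)
qed

section \<open>Measurability of the matching event\<close>

text \<open>Serves measurability: the split is expressed by positions in a fixed index list
  \<open>js\<close>, so that the existential quantifier is finite and the sublists for a given
  \<open>k\<close> do not depend on \<open>f\<close>.\<close>

lemma shape_map_eq_Node_iff:
  "shape (map f js) = Node l () r \<longleftrightarrow>
    (\<exists>k\<in>{..<length js}. (\<forall>j\<in>set (take k js). f (js ! k) < f j) \<and>
      (\<forall>j\<in>set (drop (Suc k) js). f (js ! k) \<le> f j) \<and>
      shape (map f (take k js)) = l \<and> shape (map f (drop (Suc k) js)) = r)" (is "_ \<longleftrightarrow> ?R")
proof
  assume "shape (map f js) = Node l () r"
  then obtain ys x zs where *: "map f js = ys @ x # zs" "\<forall>y\<in>set ys. x < y" "\<forall>z\<in>set zs. x \<le> z"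
    "shape ys = l" "shape zs = r"
    unfolding shape_eq_Node_iff by blast
  then obtain us v ws where "js = us @ v # ws" "ys = map f us" "x = f v" "zs = map f ws"
    by (auto simp: map_eq_append_conv map_eq_Cons_conv)
  with * show ?R
    by (intro bexI[of _ "length us"]) auto
next
  assume ?R
  then obtain k where k: "k < length js" "\<forall>j\<in>set (take k js). f (js ! k) < f j"
      "\<forall>j\<in>set (drop (Suc k) js). f (js ! k) \<le> f j"
      "shape (map f (take k js)) = l" "shape (map f (drop (Suc k) js)) = r"
    by auto
  have "map f js = map f (take k js) @ f (js ! k) # map f (drop (Suc k) js)"
    using id_take_nth_drop[OF k(1)] by (metis list.map(2) map_append)
  with k show "shape (map f js) = Node l () r"
    by (simp only:) (subst shape_split; auto)
qed

text \<open>Induction on \<open>t\<close> exhibits the event as a finite Boolean combination of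
  comparisons between the \<open>Z j\<close>. The list \<open>js\<close> is generalized because the
  induction hypotheses are applied to its prefixes and suffixes.\<close>

lemma measurable_shape_eq:
  fixes Z :: "'i \<Rightarrow> 'w \<Rightarrow> real"
  assumes "\<And>j. j \<in> set js \<Longrightarrow> Z j \<in> borel_measurable N"
  shows "Measurable.pred N (\<lambda>\<omega>. shape (map (\<lambda>j. Z j \<omega>) js) = t)"
  using assms
proof (induction t arbitrary: js)
  case Leaf
  then show ?case by simp
next
  case (Node l u r)
  have sub: "Measurable.pred N (\<lambda>\<omega>. shape (map (\<lambda>j. Z j \<omega>) (take k js)) = l)"
    "Measurable.pred N (\<lambda>\<omega>. shape (map (\<lambda>j. Z j \<omega>) (drop k js)) = r)" for k
    using Node.prems by (auto intro!: Node.IH dest: in_set_takeD in_set_dropD)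
  have cmp: "Measurable.pred N (\<lambda>\<omega>. Z i \<omega> < Z j \<omega>)" "Measurable.pred N (\<lambda>\<omega>. Z i \<omega> \<le> Z j \<omega>)"
    if "i \<in> set js" "j \<in> set js" for i j
    using borel_measurable_less[OF Node.prems Node.prems, OF that]
      borel_measurable_le[OF Node.prems Node.prems, OF that] by (simp_all add: pred_def)
  have cmp_all:
    "Measurable.pred N (\<lambda>\<omega>. \<forall>j\<in>set (take k js). Z (js ! k) \<omega> < Z j \<omega>)"
    "Measurable.pred N (\<lambda>\<omega>. \<forall>j\<in>set (drop (Suc k) js). Z (js ! k) \<omega> \<le> Z j \<omega>)"
    if "k \<in> {..<length js}" for k
    using that by (auto intro!: pred_intros_finite(3) cmp[OF nth_mem] elim: in_set_takeD in_set_dropD)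
  show ?case
    unfolding unit_eq[of u] shape_map_eq_Node_iff
    by (intro pred_intros_finite(4) pred_intros_logic(3) cmp_all sub) simp_all
qed

text \<open>A match is a finite union, over the shapes \<open>t\<close> of size \<open>n\<close>, of
  the events that both strings have shape \<open>t\<close>.\<close>

lemma measurable_same_cartesian_tree:
  fixes X Y :: "nat \<Rightarrow> 'w \<Rightarrow> real"
  assumes "\<And>i. i < n \<Longrightarrow> X i \<in> borel_measurable N" "\<And>i. i < n \<Longrightarrow> Y i \<in> borel_measurable N"
  shows "Measurable.pred N
    (\<lambda>\<omega>. same_cartesian_tree (map (\<lambda>i. X i \<omega>) [0..<n]) (map (\<lambda>i. Y i \<omega>) [0..<n]))"
proof -
  have [measurable]: "Measurable.pred N (\<lambda>\<omega>. shape (map (\<lambda>i. X i \<omega>) [0..<n]) = t)"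
    "Measurable.pred N (\<lambda>\<omega>. shape (map (\<lambda>i. Y i \<omega>) [0..<n]) = t)" for t
    using assms by (auto intro!: measurable_shape_eq)
  have "same_cartesian_tree (map (\<lambda>i. X i \<omega>) [0..<n]) (map (\<lambda>i. Y i \<omega>) [0..<n]) \<longleftrightarrow>
      (\<exists>t\<in>trees_of_size n. shape (map (\<lambda>i. X i \<omega>) [0..<n]) = t \<and> shape (map (\<lambda>i. Y i \<omega>) [0..<n]) = t)" for \<omega>
    by (auto simp: same_cartesian_tree_def trees_of_size_def simp flip: shape_def)
  moreover have "Measurable.pred N (\<lambda>\<omega>. \<exists>t\<in>trees_of_size n.
      shape (map (\<lambda>i. X i \<omega>) [0..<n]) = t \<and> shape (map (\<lambda>i. Y i \<omega>) [0..<n]) = t)"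
    by (intro pred_intros_finite pred_intros_logic) measurable
  ultimately show ?thesis
    by simp
qed

section \<open>Exchangeability and averaging\<close>

text \<open>The permuted and the original family have the same joint law, the product measure of
  copies of \<open>D\<close>.\<close>

lemma (in prob_space) prob_iid_permute:
  assumes indep: "indep_vars (\<lambda>_. N) Z I"
    and distr: "\<And>i. i \<in> I \<Longrightarrow> distr M N (Z i) = D"
    and \<pi>: "bij_betw \<pi> I I"
    and P: "Measurable.pred (PiM I (\<lambda>_. N)) P"
  shows "prob {\<omega> \<in> space M. P (\<lambda>i\<in>I. Z (\<pi> i) \<omega>)} = prob {\<omega> \<in> space M. P (\<lambda>i\<in>I. Z i \<omega>)}"
proof (cases "I = {}")
  \<comment> \<open>A nonempty \<open>I\<close> supplies an index that shows \<open>D\<close> to be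
    a probability measure with the sets of \<open>N\<close>. For empty \<open>I\<close> both
    restricted families are the same function.\<close>
  case False
  have prob_eq: "prob {\<omega> \<in> space M. P (\<lambda>i\<in>I. Z (\<pi> i) \<omega>)} =
      measure (PiM I (\<lambda>_. D)) {f \<in> space (PiM I (\<lambda>_. N)). P f}"
    if \<pi>: "bij_betw \<pi> I I" for \<pi>
  proof -
    have rv: "random_variable N (Z i)" if "i \<in> I" for i
      using indep that by (simp add: indep_vars_def)
    have \<pi>_in: "\<pi> i \<in> I" if "i \<in> I" for i
      using \<pi> that by (rule bij_betw_apply)
    have D: "prob_space D" "sets D = sets N"
      using False rv distr by (metis ex_in_conv prob_space_distr, metis ex_in_conv sets_distr)
    have sets_PiM: "sets (PiM I (\<lambda>_. D)) = sets (PiM I (\<lambda>_. N))"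
      using D(2) by (intro sets_PiM_cong) auto
    \<comment> \<open>The permuted family is the original one followed by a reindexing of
      coordinates, and a product of equal factors is invariant under that reindexing.\<close>
    have "distr M (PiM I (\<lambda>_. N)) (\<lambda>\<omega>. \<lambda>i\<in>I. Z (\<pi> i) \<omega>) =
        distr (distr M (PiM I (\<lambda>_. N)) (\<lambda>\<omega>. \<lambda>i\<in>I. Z i \<omega>)) (PiM I (\<lambda>_. N)) (\<lambda>f. \<lambda>i\<in>I. f (\<pi> i))"
    proof (subst distr_distr)
      show "(\<lambda>f. \<lambda>i\<in>I. f (\<pi> i)) \<in> measurable (PiM I (\<lambda>_. N)) (PiM I (\<lambda>_. N))"
        using \<pi>_in by (intro measurable_restrict measurable_component_singleton) auto
      show "(\<lambda>\<omega>. \<lambda>i\<in>I. Z i \<omega>) \<in> measurable M (PiM I (\<lambda>_. N))"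
        using rv by (intro measurable_restrict) auto
    qed (auto simp: comp_def \<pi>_in cong: restrict_cong)
    also have "distr M (PiM I (\<lambda>_. N)) (\<lambda>\<omega>. \<lambda>i\<in>I. Z i \<omega>) = PiM I (\<lambda>i. distr M N (Z i))"
      using indep_vars_iff_distr_eq_PiM'[of I Z "\<lambda>_. N"] False rv indep by auto
    also have "\<dots> = PiM I (\<lambda>_. D)"
      by (intro PiM_cong) (auto simp: distr)
    also have "distr \<dots> (PiM I (\<lambda>_. N)) (\<lambda>f. \<lambda>i\<in>I. f (\<pi> i)) =
        distr (PiM I (\<lambda>_. D)) (PiM I (\<lambda>_. D)) (\<lambda>f. \<lambda>i\<in>I. f (\<pi> i))"
      by (intro distr_cong) (auto simp: sets_PiM)
    also have "\<dots> = PiM I (\<lambda>_. D)"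
      using distr_PiM_reindex[where K = I and I = I and f = \<pi> and M = "\<lambda>_. D"] \<pi> \<pi>_in D(1)
      by (auto simp: bij_betw_def)
    finally have law: "distr M (PiM I (\<lambda>_. N)) (\<lambda>\<omega>. \<lambda>i\<in>I. Z (\<pi> i) \<omega>) = PiM I (\<lambda>_. D)" .
    have meas: "(\<lambda>\<omega>. \<lambda>i\<in>I. Z (\<pi> i) \<omega>) \<in> measurable M (PiM I (\<lambda>_. N))"
      using rv \<pi>_in by (intro measurable_restrict) auto
    from law have "measure (PiM I (\<lambda>_. D)) {f \<in> space (PiM I (\<lambda>_. N)). P f} =
        measure (distr M (PiM I (\<lambda>_. N)) (\<lambda>\<omega>. \<lambda>i\<in>I. Z (\<pi> i) \<omega>)) {f \<in> space (PiM I (\<lambda>_. N)). P f}"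
      by simp
    also have "measure (distr M (PiM I (\<lambda>_. N)) (\<lambda>\<omega>. \<lambda>i\<in>I. Z (\<pi> i) \<omega>)) {f \<in> space (PiM I (\<lambda>_. N)). P f} =
        prob ((\<lambda>\<omega>. \<lambda>i\<in>I. Z (\<pi> i) \<omega>) -` {f \<in> space (PiM I (\<lambda>_. N)). P f} \<inter> space M)"
      using P by (intro measure_distr meas) (simp add: pred_def)
    also have "(\<lambda>\<omega>. \<lambda>i\<in>I. Z (\<pi> i) \<omega>) -` {f \<in> space (PiM I (\<lambda>_. N)). P f} \<inter> space M =
        {\<omega> \<in> space M. P (\<lambda>i\<in>I. Z (\<pi> i) \<omega>)}"
      using measurable_space[OF meas] by auto
    finally show ?thesis by simp
  qed
  show ?thesis
    using prob_eq[OF \<pi>] prob_eq[of id] by simp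
qed (simp add: restrict_def)

text \<open>Linearity of expectation: the sum of the indicators of the \<open>E k\<close> is the
  number of events that occur, almost surely the constant \<open>c\<close>.\<close>

lemma (in prob_space) sum_prob_eq_AE_card:
  assumes "finite K" "\<And>k. k \<in> K \<Longrightarrow> E k \<in> events"
    and "AE \<omega> in M. real (card {k \<in> K. \<omega> \<in> E k}) = c"
  shows "(\<Sum>k\<in>K. prob (E k)) = c"
proof -
  have "(\<Sum>k\<in>K. prob (E k)) = (\<Sum>k\<in>K. expectation (indicator (E k)))"
    using assms(2) by (intro sum.cong) (auto simp: sets.sets_into_space Int_absorb2)
  also have "\<dots> = expectation (\<lambda>\<omega>. \<Sum>k\<in>K. indicator (E k) \<omega>)"
    using assms(2) by (subst Bochner_Integration.integral_sum)
      (auto simp: emeasure_eq_measure intro!: integrable_real_indicator)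
  also have "\<dots> = expectation (\<lambda>_. c)"
  proof (rule integral_cong_AE)
    show "AE \<omega> in M. (\<Sum>k\<in>K. indicator (E k) \<omega>) = c"
      using assms(3)
    proof eventually_elim
      case (elim \<omega>)
      then show ?case
        using assms(1) by (simp add: indicator_def sum.If_cases Int_def)
    qed
  qed (use assms(2) in auto)
  finally show ?thesis
    by (simp add: prob_space)
qed

section \<open>The probability of equal Cartesian trees\<close>

theorem theorem1:
  fixes M :: "'w measure" and D :: "real measure"
    and X Y :: "nat \<Rightarrow> 'w \<Rightarrow> real" and n :: nat
  assumes "prob_space M"
    and "n \<ge> 1"
    and indep: "prob_space.indep_vars M (\<lambda>_. borel) (case_sum X Y) ({..<n} <+> {..<n})"
    and distr_X: "\<And>i. i < n \<Longrightarrow> distr M borel (X i) = D"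
    and distr_Y: "\<And>i. i < n \<Longrightarrow> distr M borel (Y i) = D"
    and distinct_X: "AE \<omega> in M. distinct (random_string n X \<omega>)"
    and distinct_Y: "AE \<omega> in M. distinct (random_string n Y \<omega>)"
  shows "measure M {\<omega> \<in> space M. same_cartesian_tree (random_string n X \<omega>) (random_string n Y \<omega>)}
    \<le> 1 / 2 ^ (n - 1)"
proof -
  interpret prob_space M by fact
  \<comment> \<open>The disjoint sum merges the two strings into a single i.i.d. family;
    \<open>map_sum \<sigma> \<tau>\<close> then permutes each string within itself.\<close>
  define I :: "(nat + nat) set" where "I = {..<n} <+> {..<n}"
  define P where "P f \<longleftrightarrow>
    same_cartesian_tree (map (\<lambda>i. f (Inl i)) [0..<n]) (map (\<lambda>i. f (Inr i)) [0..<n])"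
    for f :: "nat + nat \<Rightarrow> real"
  define S where "S = {\<sigma>. \<sigma> permutes {..<n}}"
  define E where "E = (\<lambda>(\<sigma>, \<tau>). {\<omega> \<in> space M.
    same_cartesian_tree (map (\<lambda>i. X (\<sigma> i) \<omega>) [0..<n]) (map (\<lambda>i. Y (\<tau> i) \<omega>) [0..<n])})"
  define p where "p = prob (E (id, id))"
  define c where "c = (\<Sum>t\<in>trees_of_size n. (tree_weight t)\<^sup>2)"
  have Z: "X i \<in> borel_measurable M" "Y i \<in> borel_measurable M" if "i < n" for i
    using indep that by (auto simp: indep_vars_def dest: bspec[of _ _ "Inl i"] bspec[of _ _ "Inr i"])
  have S: "finite S" "card S = fact n"
    by (simp_all add: S_def finite_permutations card_permutations)
  have S_less: "\<sigma> i < n" if "\<sigma> \<in> S" "i < n" for \<sigma> i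
    using that permutes_in_image[of \<sigma> "{..<n}" i] by (simp add: S_def)
  have "Measurable.pred (PiM I (\<lambda>_. borel)) P"
    unfolding P_def by (intro measurable_same_cartesian_tree measurable_component_singleton) (auto simp: I_def)
  moreover have "bij_betw (map_sum \<sigma> \<tau>) I I" if "\<sigma> \<in> S" "\<tau> \<in> S" for \<sigma> \<tau>
  proof (rule bij_betwI')
    have inj: "inj \<sigma>" "inj \<tau>" and im: "\<sigma> ` {..<n} = {..<n}" "\<tau> ` {..<n} = {..<n}"
      using that by (auto simp: S_def permutes_inj permutes_image)
    show "map_sum \<sigma> \<tau> a = map_sum \<sigma> \<tau> b \<longleftrightarrow> a = b" for a b
      using inj by (cases a; cases b) (auto dest: injD)
    show "map_sum \<sigma> \<tau> a \<in> I" if "a \<in> I" for a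
      using that S_less \<open>\<sigma> \<in> S\<close> \<open>\<tau> \<in> S\<close> by (auto simp: I_def)
    show "\<exists>a\<in>I. b = map_sum \<sigma> \<tau> a" if "b \<in> I" for b
      using that im by (auto simp: I_def image_iff set_eq_iff) (metis InlI InrI lessThan_iff map_sum.simps)+
  qed
  moreover have "distr M borel (case_sum X Y i) = D" if "i \<in> I" for i
    using that by (auto simp: I_def distr_X distr_Y)
  ultimately have "prob {\<omega> \<in> space M. P (\<lambda>i\<in>I. case_sum X Y (map_sum \<sigma> \<tau> i) \<omega>)} =
      prob {\<omega> \<in> space M. P (\<lambda>i\<in>I. case_sum X Y i \<omega>)}" if "\<sigma> \<in> S" "\<tau> \<in> S" for \<sigma> \<tau>
    using that indep by (intro prob_iid_permute) (auto simp: I_def)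
  \<comment> \<open>Only indices below \<open>n\<close> are read, so the restriction to
    \<open>I\<close> does not change the event.\<close>
  moreover have "P (\<lambda>i\<in>I. case_sum X Y (map_sum \<sigma> \<tau> i) \<omega>) \<longleftrightarrow>
      same_cartesian_tree (map (\<lambda>i. X (\<sigma> i) \<omega>) [0..<n]) (map (\<lambda>i. Y (\<tau> i) \<omega>) [0..<n])" for \<sigma> \<tau> \<omega>
    unfolding P_def by (intro arg_cong2[where f = same_cartesian_tree] map_cong) (auto simp: I_def)
  moreover have "P (\<lambda>i\<in>I. case_sum X Y i \<omega>) \<longleftrightarrow>
      same_cartesian_tree (map (\<lambda>i. X i \<omega>) [0..<n]) (map (\<lambda>i. Y i \<omega>) [0..<n])" for \<omega>
    unfolding P_def by (intro arg_cong2[where f = same_cartesian_tree] map_cong) (auto simp: I_def)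
  ultimately have "prob (E k) = p" if "k \<in> S \<times> S" for k
    using that by (auto simp: E_def p_def)
  \<comment> \<open>Double counting: the events \<open>E k\<close> are equiprobable, and the sum of
    their probabilities can also be found by counting, for each outcome, the events that contain
    it.\<close>
  then have "(fact n)\<^sup>2 * p = (\<Sum>k\<in>S \<times> S. prob (E k))"
    using S by (simp add: card_cartesian_product power2_eq_square)
  also have "\<dots> = (fact n)\<^sup>2 * c"
  proof (rule sum_prob_eq_AE_card)
    show "E k \<in> events" if "k \<in> S \<times> S" for k
      using that measurable_same_cartesian_tree[of n "\<lambda>i. X (fst k i)" M "\<lambda>i. Y (snd k i)"] Z S_less
      by (auto simp: E_def pred_def)
    \<comment> \<open>Almost surely both strings have distinct entries, and then the number of
      matching pairs of permutations does not depend on the outcome.\<close>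
    show "AE \<omega> in M. real (card {k \<in> S \<times> S. \<omega> \<in> E k}) = (fact n)\<^sup>2 * c"
      using distinct_X distinct_Y AE_space
    proof eventually_elim
      case (elim \<omega>)
      then have "inj_on (\<lambda>i. X i \<omega>) {..<n}" "inj_on (\<lambda>i. Y i \<omega>) {..<n}"
        by (simp_all add: random_string_def distinct_map atLeast0LessThan)
      from card_permutes_same_cartesian_tree[OF this] elim(3) show ?case
        by (auto simp: c_def S_def E_def case_prod_unfold elim!: back_subst[of "\<lambda>A. real (card A) = _"])
    qed
  qed (use S in auto)
  \<comment> \<open>The probability is exactly \<open>c\<close>; only the bound on \<open>c\<close>
    is an estimate.\<close>
  finally have "p = c"
    by simp
  also have "c \<le> 1 / 2 ^ (n - 1)"
    using sum_tree_weight_le[of n] \<open>n \<ge> 1\<close> by (simp add: c_def)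
  finally show ?thesis
    by (simp add: p_def E_def random_string_def)
qed

end
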